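(* Let $G$ be a maximal $3$-$\gamma_{c}$-vertex critical graph with independence number $\alpha$ and connectivity $\kappa$. If $\alpha=\kappa$, then for every minimum vertex cut set $S$ of $G$ (i.e. $|S|=\kappa$ and $G-S$ is disconnected), the graph $G-S$ has at least one component consisting of a single vertex.
   Context: All graphs are finite, simple and connected. A set $D\subseteq V(G)$ is a connected dominating set of $G$ if every vertex of $G$ is in $D$ or adjacent to a vertex of $D$, and $G[D]$ is connected; $\gamma_{c}(G)$ is the minimum cardinality of such a set. $G$ is $k$-$\gamma_{c}$-edge critical if $\gamma_{c}(G)=k$ and $\gamma_{c}(G+uv)<k$ for every pair of non-adjacent vertices $u,v$. A $2$-connected graph $G$ is $k$-$\gamma_{c}$-vertex critical if $\gamma_{c}(G)=k$ and $\gamma_{c}(G-v)<k$ for every $v\in V(G)$. $G$ is maximal $k$-$\gamma_{c}$-vertex critical if it is both $k$-$\gamma_{c}$-edge critical and $k$-$\gamma_{c}$-vertex critical. *)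

theory Defs
  imports Main
begin

definition simple_graph :: "'a set \<Rightarrow> ('a \<Rightarrow> 'a \<Rightarrow> bool) \<Rightarrow> bool" where
  "simple_graph V E \<longleftrightarrow> finite V \<and>
     (\<forall>x y. E x y \<longrightarrow> x \<in> V \<and> y \<in> V \<and> x \<noteq> y \<and> E y x)"

definition induced :: "('a \<Rightarrow> 'a \<Rightarrow> bool) \<Rightarrow> 'a set \<Rightarrow> 'a \<Rightarrow> 'a \<Rightarrow> bool" where
  "induced E W = (\<lambda>x y. E x y \<and> x \<in> W \<and> y \<in> W)"

definition conn_on :: "('a \<Rightarrow> 'a \<Rightarrow> bool) \<Rightarrow> 'a set \<Rightarrow> bool" where
  "conn_on E W \<longleftrightarrow> W \<noteq> {} \<and> (\<forall>x\<in>W. \<forall>y\<in>W. (induced E W)\<^sup>*\<^sup>* x y)"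

definition is_component :: "('a \<Rightarrow> 'a \<Rightarrow> bool) \<Rightarrow> 'a set \<Rightarrow> 'a set \<Rightarrow> bool" where
  "is_component E W C \<longleftrightarrow> C \<subseteq> W \<and> conn_on E C \<and>
     (\<forall>C'. C \<subseteq> C' \<and> C' \<subseteq> W \<and> conn_on E C' \<longrightarrow> C' = C)"

definition conn_dom_set :: "'a set \<Rightarrow> ('a \<Rightarrow> 'a \<Rightarrow> bool) \<Rightarrow> 'a set \<Rightarrow> bool" where
  "conn_dom_set V E D \<longleftrightarrow> D \<subseteq> V \<and> (\<forall>v\<in>V. v \<in> D \<or> (\<exists>u\<in>D. E u v)) \<and> conn_on E D"

definition gamma_c :: "'a set \<Rightarrow> ('a \<Rightarrow> 'a \<Rightarrow> bool) \<Rightarrow> nat" where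
  "gamma_c V E = Min {card D | D. conn_dom_set V E D}"

definition del_vertex :: "('a \<Rightarrow> 'a \<Rightarrow> bool) \<Rightarrow> 'a \<Rightarrow> 'a \<Rightarrow> 'a \<Rightarrow> bool" where
  "del_vertex E v = (\<lambda>x y. E x y \<and> x \<noteq> v \<and> y \<noteq> v)"

definition add_edge :: "('a \<Rightarrow> 'a \<Rightarrow> bool) \<Rightarrow> 'a \<Rightarrow> 'a \<Rightarrow> 'a \<Rightarrow> 'a \<Rightarrow> bool" where
  "add_edge E u v = (\<lambda>x y. E x y \<or> (x = u \<and> y = v) \<or> (x = v \<and> y = u))"

definition k_connected :: "nat \<Rightarrow> 'a set \<Rightarrow> ('a \<Rightarrow> 'a \<Rightarrow> bool) \<Rightarrow> bool" where
  "k_connected k V E \<longleftrightarrow> card V > k \<and>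
     (\<forall>X. X \<subseteq> V \<and> card X < k \<longrightarrow> conn_on E (V - X))"

definition edge_critical :: "nat \<Rightarrow> 'a set \<Rightarrow> ('a \<Rightarrow> 'a \<Rightarrow> bool) \<Rightarrow> bool" where
  "edge_critical k V E \<longleftrightarrow> gamma_c V E = k \<and>
     (\<forall>u\<in>V. \<forall>v\<in>V. u \<noteq> v \<and> \<not> E u v \<longrightarrow> gamma_c V (add_edge E u v) < k)"

definition vertex_critical :: "nat \<Rightarrow> 'a set \<Rightarrow> ('a \<Rightarrow> 'a \<Rightarrow> bool) \<Rightarrow> bool" where
  "vertex_critical k V E \<longleftrightarrow> k_connected 2 V E \<and> gamma_c V E = k \<and>
     (\<forall>v\<in>V. gamma_c (V - {v}) (del_vertex E v) < k)"

definition maximal_vertex_critical :: "nat \<Rightarrow> 'a set \<Rightarrow> ('a \<Rightarrow> 'a \<Rightarrow> bool) \<Rightarrow> bool" where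
  "maximal_vertex_critical k V E \<longleftrightarrow> edge_critical k V E \<and> vertex_critical k V E"

definition independent :: "('a \<Rightarrow> 'a \<Rightarrow> bool) \<Rightarrow> 'a set \<Rightarrow> bool" where
  "independent E I \<longleftrightarrow> (\<forall>x\<in>I. \<forall>y\<in>I. \<not> E x y)"

definition indep_number :: "'a set \<Rightarrow> ('a \<Rightarrow> 'a \<Rightarrow> bool) \<Rightarrow> nat" where
  "indep_number V E = Max {card I | I. I \<subseteq> V \<and> independent E I}"

definition vertex_cut :: "'a set \<Rightarrow> ('a \<Rightarrow> 'a \<Rightarrow> bool) \<Rightarrow> 'a set \<Rightarrow> bool" where
  "vertex_cut V E S \<longleftrightarrow> S \<subseteq> V \<and> V - S \<noteq> {} \<and> \<not> conn_on E (V - S)"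

definition connectivity :: "'a set \<Rightarrow> ('a \<Rightarrow> 'a \<Rightarrow> bool) \<Rightarrow> nat" where
  "connectivity V E = Min {card S | S. S \<subseteq> V \<and>
      (card (V - S) \<le> 1 \<or> \<not> conn_on E (V - S))}"

end

theory Submission
  imports Defs
begin

text \<open>
  Suppose that \<open>G - S\<close> has no singleton component, and write \<open>V - S\<close> as a union of nonempty parts
  \<open>A\<close>, \<open>B\<close> with no edges between them. Vertex criticality gives for every \<open>v\<close> an edge that
  dominates all vertices but \<open>v\<close>. Such an edge has an end in \<open>S\<close>, and if its other end lies in \<open>A\<close>,
  then the end in \<open>S\<close> is adjacent to all of \<open>B - {v}\<close>. For \<open>\<alpha> = |S| = 2\<close> this is already
  contradictory, since \<open>A\<close> is then a clique and each vertex of \<open>S\<close> is complete to \<open>A\<close> or to \<open>B\<close>.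

  If \<open>|S| \<ge> 3\<close>, let \<open>I\<close> be independent with \<open>|I| = |S|\<close>. By edge criticality, for any two
  \<open>u, v \<in> I\<close> some edge \<open>uw\<close> dominates all vertices but \<open>v\<close>, or with the roles of \<open>u\<close> and \<open>v\<close>
  exchanged. Then \<open>v\<close> is the only vertex of \<open>I\<close> not adjacent to \<open>w\<close>, so \<open>w\<close> determines \<open>v\<close>, and
  \<open>w \<in> S - I\<close> if \<open>u \<notin> S\<close>. Note that \<open>|S - I| = |I - S|\<close>. If every \<open>v \<in> I - S\<close> is left out by such
  an edge with \<open>u \<in> I - S\<close>, the vertices \<open>w\<close> exhaust \<open>S - I\<close> and form a clique, and no edge
  dominates all vertices but one of them. So some \<open>x \<in> I - S\<close>, say in \<open>A\<close>, is never left out, and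
  the edges at \<open>x\<close> provide all of \<open>S - I\<close> except one vertex \<open>z\<close>.

  If \<open>I - S \<subseteq> A\<close>, then \<open>S - I\<close> is complete to \<open>B\<close>. The edge \<open>pq\<close> for some \<open>b \<in> B - I\<close> therefore
  has an end \<open>p \<in> I \<inter> S\<close>, and \<open>p\<close> turns out to be the only vertex of \<open>I\<close> not adjacent to \<open>z\<close>. If
  \<open>|I - S| \<ge> 2\<close>, then \<open>S - I\<close> is again a clique. If \<open>I - S = {x}\<close>, then the edge for \<open>q\<close> must use
  \<open>z\<close>, because \<open>q\<close> is complete to \<open>I\<close>; so neither \<open>p\<close> nor \<open>q\<close> is adjacent to \<open>z\<close>, a contradiction.
  If \<open>I - S\<close> also meets \<open>B\<close>, then \<open>z\<close> is complete to \<open>A\<close> but has no neighbour in \<open>B - I\<close>, and no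
  edge dominates all vertices but some \<open>a \<in> A - I\<close>.
\<close>

section \<open>Connected sets and extremal numbers\<close>

lemma conn_on_singleton: "conn_on E {v}"
  unfolding conn_on_def by simp

lemma conn_on_edge:
  assumes "E p q" "E q p"
  shows "conn_on E {p, q}"
proof -
  have "induced E {p, q} p q" "induced E {p, q} q p"
    using assms unfolding induced_def by auto
  then show ?thesis unfolding conn_on_def by auto
qed

lemma conn_on_mono:
  assumes "conn_on E W" and "\<And>u v. u \<in> W \<Longrightarrow> v \<in> W \<Longrightarrow> E u v \<Longrightarrow> F u v"
  shows "conn_on F W"
proof -
  have "induced E W \<le> induced F W" using assms(2) unfolding induced_def by blast
  then have "(induced E W)\<^sup>*\<^sup>* \<le> (induced F W)\<^sup>*\<^sup>*" by (rule rtranclp_mono)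
  then show ?thesis using assms(1) unfolding conn_on_def by blast
qed

lemma conn_on_neighbour:
  assumes "conn_on E W" "v \<in> W" "W \<noteq> {v}"
  shows "\<exists>w\<in>W. w \<noteq> v \<and> E v w"
proof -
  obtain u where "u \<in> W" "u \<noteq> v" using assms(2,3) by blast
  then have "(induced E W)\<^sup>*\<^sup>* v u" using assms(1,2) unfolding conn_on_def by blast
  then show ?thesis using \<open>u \<noteq> v\<close>
  proof (induction rule: rtranclp_induct)
    case (step s t)
    then show ?case unfolding induced_def by (cases "s = v") auto
  qed simp
qed

lemma is_component_isolated:
  assumes "v \<in> W" and "\<And>u. u \<in> W \<Longrightarrow> \<not> E v u"
  shows "is_component E W {v}"
  unfolding is_component_def
proof (intro conjI allI impI conn_on_singleton)
  show "{v} \<subseteq> W" using assms(1) by simp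
  show "C = {v}" if "{v} \<subseteq> C \<and> C \<subseteq> W \<and> conn_on E C" for C
    using conn_on_neighbour[of E C v] assms(2) that by blast
qed

lemma not_conn_on_split:
  assumes "W \<noteq> {}" "\<not> conn_on E W"
  obtains A B where "W = A \<union> B" "A \<inter> B = {}" "A \<noteq> {}" "B \<noteq> {}"
    "\<And>a b. a \<in> A \<Longrightarrow> b \<in> B \<Longrightarrow> \<not> E a b"
proof -
  obtain u w where uw: "u \<in> W" "w \<in> W" "\<not> (induced E W)\<^sup>*\<^sup>* u w"
    using assms unfolding conn_on_def by blast
  let ?A = "{a \<in> W. (induced E W)\<^sup>*\<^sup>* u a}"
  show ?thesis
  proof (rule that[of ?A "W - ?A"])
    show "?A \<noteq> {}" "W - ?A \<noteq> {}" using uw by auto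
    show "\<not> E a b" if "a \<in> ?A" "b \<in> W - ?A" for a b
    proof
      assume "E a b"
      then have "induced E W a b" using that unfolding induced_def by blast
      then show False using that by (auto intro: rtranclp.rtrancl_into_rtrancl)
    qed
  qed auto
qed

lemma finite_cards_of_subsets:
  assumes "finite V" and "\<And>X. P X \<Longrightarrow> X \<subseteq> V"
  shows "finite {card X | X. P X}"
proof -
  have "{card X | X. P X} \<subseteq> card ` Pow V" using assms(2) by blast
  then show ?thesis using assms(1) finite_subset by blast
qed

lemma conn_dom_set_subset: "conn_dom_set V E D \<Longrightarrow> D \<subseteq> V"
  unfolding conn_dom_set_def by blast

lemma gamma_c_le:
  assumes "finite V" "conn_dom_set V E D"
  shows "gamma_c V E \<le> card D"
  unfolding gamma_c_def
  using assms conn_dom_set_subset by (intro Min_le finite_cards_of_subsets[of V]) auto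

lemma gamma_c_attained:
  assumes "finite V" "conn_on E V"
  obtains D where "conn_dom_set V E D" "card D = gamma_c V E"
proof -
  have "conn_dom_set V E V" using assms(2) unfolding conn_dom_set_def by blast
  then have "gamma_c V E \<in> {card D | D. conn_dom_set V E D}"
    unfolding gamma_c_def
    using assms(1) conn_dom_set_subset by (intro Min_in finite_cards_of_subsets[of V]) auto
  then show ?thesis using that by auto
qed

lemma indep_number_ge:
  assumes "finite V" "I \<subseteq> V" "independent E I"
  shows "card I \<le> indep_number V E"
  unfolding indep_number_def using assms by (intro Max_ge finite_cards_of_subsets[of V]) auto

lemma indep_number_attained:
  assumes "finite V"
  obtains I where "I \<subseteq> V" "independent E I" "card I = indep_number V E"
proof -
  have "independent E {}" unfolding independent_def by blast
  then have "indep_number V E \<in> {card I | I. I \<subseteq> V \<and> independent E I}"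
    unfolding indep_number_def using assms by (intro Max_in finite_cards_of_subsets[of V]) auto
  then show ?thesis using that by auto
qed

lemma dominating_edge_if_gamma_c_less_3:
  assumes "finite V" "conn_on E V" "gamma_c V E < 3" "1 < card V"
  obtains p q where "p \<in> V" "q \<in> V" "p \<noteq> q" "E p q"
    "\<forall>x\<in>V. x = p \<or> x = q \<or> E p x \<or> E q x"
proof -
  obtain D where D: "conn_dom_set V E D" "card D < 3"
    using gamma_c_attained[OF assms(1,2)] assms(3) by metis
  then have dominating: "D \<subseteq> V" "conn_on E D" "\<forall>x\<in>V. x \<in> D \<or> (\<exists>u\<in>D. E u x)"
    unfolding conn_dom_set_def by blast+
  then have "card D \<noteq> 0" using assms(1) finite_subset unfolding conn_on_def by fastforce
  then consider "card D = 1" | "card D = 2" using D(2) by linarith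
  then show thesis
  proof cases
    case 1
    then obtain p where p: "D = {p}" by (rule card_1_singletonE)
    moreover have "V \<noteq> {p}" using assms(4) by auto
    ultimately obtain q where "q \<in> V" "q \<noteq> p" using dominating(1) by blast
    then show thesis using that[of p q] dominating p by blast
  next
    case 2
    then obtain p q where pq: "D = {p, q}" "p \<noteq> q" by (meson card_2_iff)
    moreover have "E p q" using conn_on_neighbour[of E D p] dominating(2) pq by blast
    ultimately show thesis using that[of p q] dominating by blast
  qed
qed

section \<open>Edges that dominate all but one vertex\<close>

locale fin_simple_graph =
  fixes V :: "'a set" and E :: "'a \<Rightarrow> 'a \<Rightarrow> bool"
  assumes simple: "simple_graph V E"
begin

lemma finite_V: "finite V"
  using simple unfolding simple_graph_def by blast

lemma edge_sym: "E u v \<Longrightarrow> E v u"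
  and edge_irrefl: "\<not> E u u"
  and edge_in_V: "E u v \<Longrightarrow> u \<in> V" "E u v \<Longrightarrow> v \<in> V"
  using simple unfolding simple_graph_def by blast+

lemma edge_among_three:
  assumes "indep_number V E \<le> 2" "{u, v, w} \<subseteq> V" "u \<noteq> v" "u \<noteq> w" "v \<noteq> w"
  shows "E u v \<or> E u w \<or> E v w"
proof (rule ccontr)
  assume "\<not> ?thesis"
  then have "independent E {u, v, w}"
    using edge_sym edge_irrefl unfolding independent_def by blast
  then have "card {u, v, w} \<le> 2"
    using indep_number_ge[OF finite_V assms(2)] assms(1) le_trans by blast
  then show False using assms(3-5) by simp
qed

definition dominates_but :: "'a \<Rightarrow> 'a \<Rightarrow> 'a \<Rightarrow> bool" where
  "dominates_but p q v \<longleftrightarrow> v \<in> V \<and> E p q \<and>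
     (\<forall>x\<in>V. (x = p \<or> x = q \<or> E p x \<or> E q x) \<longleftrightarrow> x \<noteq> v)"

lemma dominates_but_commute: "dominates_but p q v \<Longrightarrow> dominates_but q p v"
  unfolding dominates_but_def using edge_sym by blast

lemma dominates_butD:
  assumes "dominates_but p q v"
  shows "E p q" "p \<noteq> q" "v \<in> V" "p \<in> V" "q \<in> V"
    "p \<noteq> v" "q \<noteq> v" "\<not> E p v" "\<not> E q v" "\<not> E v p" "\<not> E v q"
  using assms edge_sym edge_irrefl edge_in_V unfolding dominates_but_def by blast+

lemma dominates_but_cover:
  assumes "dominates_but p q v" "x \<in> V" "x \<noteq> v" "x \<noteq> p" "x \<noteq> q" "\<not> E p x"
  shows "E q x"
  using assms unfolding dominates_but_def by blast

end

locale gamma_c_3_graph = fin_simple_graph +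
  assumes conn: "conn_on E V"
    and gamma_c_eq_3: "gamma_c V E = 3"
begin

lemma no_dominating_edge:
  assumes "E p q"
  shows "\<exists>x\<in>V. x \<noteq> p \<and> x \<noteq> q \<and> \<not> E p x \<and> \<not> E q x"
proof (rule ccontr)
  assume "\<not> ?thesis"
  then have "conn_dom_set V E {p, q}"
    using edge_in_V[OF assms] conn_on_edge[of E p q] assms edge_sym
    unfolding conn_dom_set_def by blast
  then have "3 \<le> card {p, q}" using gamma_c_le[OF finite_V] gamma_c_eq_3 by metis
  then show False by (simp add: card_insert_if split: if_splits)
qed

lemma dominates_butI:
  assumes "E p q" "v \<in> V" and cover: "\<forall>x\<in>V. x = v \<or> x = p \<or> x = q \<or> E p x \<or> E q x"
  shows "dominates_but p q v"
proof -
  obtain x where "x \<in> V" "x \<noteq> p" "x \<noteq> q" "\<not> E p x" "\<not> E q x"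
    using no_dominating_edge[OF assms(1)] by blast
  moreover from this have "x = v" using cover by blast
  ultimately show ?thesis using assms unfolding dominates_but_def by blast
qed

lemma vertex_critical_imp_dominates_but:
  assumes "vertex_critical 3 V E" "v \<in> V"
  shows "\<exists>p q. dominates_but p q v"
proof -
  let ?F = "del_vertex E v"
  have two_connected: "2 < card V" "\<And>X. X \<subseteq> V \<Longrightarrow> card X < 2 \<Longrightarrow> conn_on E (V - X)"
    and less: "gamma_c (V - {v}) ?F < 3"
    using assms unfolding vertex_critical_def k_connected_def by blast+
  have "conn_on E (V - {v})" using two_connected(2)[of "{v}"] assms(2) by simp
  then have "conn_on ?F (V - {v})"
    by (rule conn_on_mono) (simp add: del_vertex_def)
  moreover have "finite (V - {v})" "1 < card (V - {v})"
    using finite_V two_connected(1) assms(2) by simp_all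
  ultimately obtain p q where "?F p q"
      "\<forall>x\<in>V - {v}. x = p \<or> x = q \<or> ?F p x \<or> ?F q x"
    using dominating_edge_if_gamma_c_less_3[OF _ _ less] by blast
  then have "dominates_but p q v"
    using assms(2) unfolding del_vertex_def by (intro dominates_butI) blast+
  then show ?thesis by blast
qed

lemma new_edge_end_dominates_but:
  assumes "{u, v} \<subseteq> V" "u \<noteq> v" "c \<in> {u, v}" "w \<notin> {u, v}" "add_edge E u v c w"
    "\<forall>x\<in>V. x = c \<or> x = w \<or> add_edge E u v c x \<or> add_edge E u v w x"
  shows "(\<exists>w. dominates_but u w v) \<or> (\<exists>w. dominates_but v w u)"
proof (cases "c = u")
  case True
  then have "dominates_but u w v"
    using assms unfolding add_edge_def by (intro dominates_butI) auto
  then show ?thesis by blast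
next
  case False
  then have "dominates_but v w u"
    using assms unfolding add_edge_def by (intro dominates_butI) auto
  then show ?thesis by blast
qed

lemma edge_critical_imp_dominates_but:
  assumes "edge_critical 3 V E" "{u, v, t} \<subseteq> V" "independent E {u, v, t}"
    and distinct: "u \<noteq> v" "t \<noteq> u" "t \<noteq> v"
  shows "(\<exists>w. dominates_but u w v) \<or> (\<exists>w. dominates_but v w u)"
proof -
  let ?F = "add_edge E u v"
  have uv: "{u, v} \<subseteq> V" "u \<noteq> v" using assms(2) distinct(1) by blast+
  have nonadj: "\<not> E u v" "\<not> E u t" "\<not> E v t"
    using assms(3) unfolding independent_def by blast+
  have "conn_on ?F V" by (rule conn_on_mono[OF conn]) (simp add: add_edge_def)
  moreover have "gamma_c V ?F < 3"
    using assms(1,2) distinct(1) nonadj(1) unfolding edge_critical_def by blast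
  moreover have "1 < card V"
    using card_mono[OF finite_V, of "{u, v}"] assms(2) distinct(1) by simp
  ultimately obtain p q where pq: "p \<noteq> q" "?F p q"
      "\<forall>x\<in>V. x = p \<or> x = q \<or> ?F p x \<or> ?F q x"
    using dominating_edge_if_gamma_c_less_3[OF finite_V] by metis
  have "?F q p" using pq(2) edge_sym unfolding add_edge_def by blast
  consider "p \<in> {u, v}" "q \<in> {u, v}" | "p \<notin> {u, v}" "q \<notin> {u, v}"
    | "p \<in> {u, v}" "q \<notin> {u, v}" | "q \<in> {u, v}" "p \<notin> {u, v}" by blast
  then show ?thesis
  proof cases
    case 1
    then have "?F u t \<or> ?F v t" using pq(1,3) assms(2) distinct by blast
    then show ?thesis using nonadj distinct unfolding add_edge_def by blast
  next
    case 2
    then show ?thesis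
      using no_dominating_edge[of p q] pq(2,3) unfolding add_edge_def by blast
  next
    case 3
    then show ?thesis using new_edge_end_dominates_but[of u v p q] uv pq(2,3) by blast
  next
    case 4
    then show ?thesis using new_edge_end_dominates_but[of u v q p] uv \<open>?F q p\<close> pq(3) by blast
  qed
qed

end

locale maximal_critical_graph = gamma_c_3_graph +
  assumes maximal_critical: "maximal_vertex_critical 3 V E"
begin

lemma edge_critical: "edge_critical 3 V E" and vertex_critical: "vertex_critical 3 V E"
  using maximal_critical unfolding maximal_vertex_critical_def by blast+

end

section \<open>Graphs separated by a vertex cut\<close>

locale separated_critical_graph = maximal_critical_graph +
  fixes S A B :: "'a set"
  assumes V_eq: "V = S \<union> A \<union> B"
    and disjoint: "S \<inter> A = {}" "S \<inter> B = {}" "A \<inter> B = {}"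
    and nonempty: "A \<noteq> {}" "B \<noteq> {}"
    and separated: "a \<in> A \<Longrightarrow> b \<in> B \<Longrightarrow> \<not> E a b"
    and no_isolated: "v \<in> A \<union> B \<Longrightarrow> \<exists>u\<in>A \<union> B. E v u"
begin

lemma swap: "separated_critical_graph V E S B A"
proof unfold_locales
  show "V = S \<union> B \<union> A" "B \<inter> A = {}" using V_eq disjoint by blast+
  show "\<not> E a b" if "a \<in> B" "b \<in> A" for a b using separated edge_sym that by blast
  show "\<exists>u\<in>B \<union> A. E v u" if "v \<in> B \<union> A" for v using no_isolated that by blast
qed (fact disjoint nonempty)+

lemma S_sub: "S \<subseteq> V" and A_sub: "A \<subseteq> V" and B_sub: "B \<subseteq> V"
  using V_eq by blast+

lemma edge_from_A: "E a v \<Longrightarrow> a \<in> A \<Longrightarrow> v \<notin> S \<Longrightarrow> v \<in> A"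
  using separated edge_in_V V_eq by blast

lemma edge_from_B: "E b v \<Longrightarrow> b \<in> B \<Longrightarrow> v \<notin> S \<Longrightarrow> v \<in> B"
  using separated edge_sym edge_in_V V_eq by blast

lemma ex_other_in_A: "\<exists>a\<in>A. a \<noteq> v"
proof -
  obtain a where a: "a \<in> A" using nonempty by blast
  then obtain a' where "a' \<in> A" "a' \<noteq> a"
    using no_isolated separated edge_irrefl by blast
  then show ?thesis using a by (cases "a = v") auto
qed

lemma partner_of_B:
  assumes "dominates_but p q v" "p \<in> B"
  shows partner_of_B_in_S: "q \<in> S"
    and partner_of_B_covers_A: "a \<in> A \<Longrightarrow> a \<noteq> v \<Longrightarrow> E q a"
proof -
  have nonadj: "a \<noteq> p" "\<not> E p a" "a \<in> V" if "a \<in> A" for a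
    using that assms(2) disjoint separated edge_sym A_sub by blast+
  show in_S: "q \<in> S"
  proof (rule ccontr)
    assume "q \<notin> S"
    then have "q \<in> B" using edge_from_B dominates_butD(1)[OF assms(1)] assms(2) by blast
    moreover obtain a where "a \<in> A" "a \<noteq> v" using ex_other_in_A by blast
    ultimately show False
      using dominates_but_cover[OF assms(1), of a] nonadj separated edge_sym disjoint by blast
  qed
  show "E q a" if "a \<in> A" "a \<noteq> v" for a
    using dominates_but_cover[OF assms(1), of a] nonadj that in_S disjoint by blast
qed

lemma
  assumes "dominates_but p q v" "p \<in> A"
  shows partner_of_A_in_S: "q \<in> S"
    and partner_of_A_covers_B: "b \<in> B \<Longrightarrow> b \<noteq> v \<Longrightarrow> E q b"
  using separated_critical_graph.partner_of_B[OF swap assms] by blast+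

lemma critical_pair_in_S:
  assumes "v \<in> V"
  obtains p q where "dominates_but p q v" "p \<in> S"
proof -
  obtain p q where pq: "dominates_but p q v"
    using vertex_critical_imp_dominates_but[OF vertex_critical assms] by blast
  then have "p \<in> S \<or> q \<in> S"
    using partner_of_A_in_S partner_of_B_in_S dominates_butD(4) V_eq by blast
  then show thesis using that pq dominates_but_commute by blast
qed

lemma not_conn_on_diff_S: "\<not> conn_on E (V - S)"
proof
  assume "conn_on E (V - S)"
  moreover obtain a b where ab: "a \<in> A" "b \<in> B" using nonempty by blast
  moreover have "a \<in> V - S" "b \<in> V - S" using ab V_eq disjoint by blast+
  ultimately have "(induced E (V - S))\<^sup>*\<^sup>* a b" unfolding conn_on_def by blast
  then have "b \<in> A"
    using ab(1)
  proof (induction rule: rtranclp_induct)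
    case (step u w)
    then show ?case using edge_from_A unfolding induced_def by blast
  qed
  then show False using ab(2) disjoint(3) by blast
qed

lemma card_S_ge_2: "2 \<le> card S"
  using vertex_critical S_sub not_conn_on_diff_S not_le_imp_less
  unfolding vertex_critical_def k_connected_def by blast

lemma clique_A_if_indep_number_le_2:
  assumes "indep_number V E \<le> 2" "a \<in> A" "a' \<in> A" "a \<noteq> a'"
  shows "E a a'"
proof -
  obtain b where "b \<in> B" using nonempty by blast
  then show ?thesis
    using edge_among_three[OF assms(1), of a a' b] assms(2-4) separated A_sub B_sub disjoint
    by blast
qed

lemma indep_number_gt_2_if_card_S_eq_2:
  assumes "card S = 2"
  shows "2 < indep_number V E"
proof (rule ccontr)
  assume "\<not> ?thesis"
  then have alpha: "indep_number V E \<le> 2" by simp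
  obtain a b where ab: "a \<in> A" "b \<in> B" using nonempty by blast
  obtain t r where t: "dominates_but t r b" "t \<in> S" using critical_pair_in_S ab B_sub by blast
  have t_adj: "E t c" if "c \<in> A" for c
    using edge_among_three[OF alpha, of t b c] dominates_butD[OF t(1)] that ab t(2)
      separated edge_sym A_sub disjoint by blast
  obtain s where s: "S = {s, t}"
    using assms t(2) by (metis card_2_iff insert_commute insertE singletonD)
  have critical_in_S: "p = s" if "dominates_but p q c" "p \<in> S" "c \<in> A" for p q c
    using t_adj dominates_butD(8)[OF that(1)] that(2,3) s by blast
  have s_nonadj: "\<not> E s c" if c: "c \<in> A" for c
  proof -
    obtain p q where "dominates_but p q c" "p \<in> S" using critical_pair_in_S c A_sub by blast
    then show ?thesis using critical_in_S c dominates_butD(8) by blast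
  qed
  obtain p q where "dominates_but p q a" "p \<in> S" using critical_pair_in_S ab(1) A_sub by blast
  moreover from this have "p = s" using critical_in_S ab(1) by blast
  ultimately have q: "dominates_but s q a" by blast
  then have "q \<notin> S" using critical_in_S[OF dominates_but_commute] dominates_butD(2) ab(1) by blast
  moreover have "q \<notin> A"
    using clique_A_if_indep_number_le_2[OF alpha] dominates_butD(7,9)[OF q] ab(1) by blast
  moreover obtain c where c: "c \<in> A" "c \<noteq> a" using ex_other_in_A by blast
  ultimately have "E q c"
    using dominates_but_cover[OF q] s_nonadj s A_sub disjoint(1) by blast
  then show False using edge_from_A edge_sym c(1) \<open>q \<notin> S\<close> \<open>q \<notin> A\<close> by blast
qed

end

lemma (in maximal_critical_graph) separated_if_no_singleton_component:
  assumes "vertex_cut V E S" and no_singleton: "\<And>v. \<not> is_component E (V - S) {v}"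
  obtains A B where "separated_critical_graph V E S A B"
proof -
  have cut: "S \<subseteq> V" "V - S \<noteq> {}" "\<not> conn_on E (V - S)"
    using assms(1) unfolding vertex_cut_def by blast+
  obtain A B where AB: "V - S = A \<union> B" "A \<inter> B = {}" "A \<noteq> {}" "B \<noteq> {}"
    "\<And>a b. a \<in> A \<Longrightarrow> b \<in> B \<Longrightarrow> \<not> E a b"
    using not_conn_on_split[OF cut(2,3)] by blast
  have "\<exists>u\<in>A \<union> B. E v u" if "v \<in> A \<union> B" for v
    using is_component_isolated[of v "V - S" E] no_singleton that AB(1) by blast
  then have "separated_critical_graph V E S A B"
    using AB cut(1) by unfold_locales blast+
  then show thesis by (rule that)
qed

section \<open>Independent sets as large as the cut\<close>

locale separated_graph_with_indep_set = separated_critical_graph +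
  fixes I :: "'a set"
  assumes I_sub: "I \<subseteq> V"
    and I_indep: "independent E I"
    and card_I_ge_3: "3 \<le> card I"
begin

lemma swap_with_indep_set: "separated_graph_with_indep_set V E S B A I"
proof -
  interpret swapped: separated_critical_graph V E S B A by (rule swap)
  show ?thesis by unfold_locales (fact I_sub I_indep card_I_ge_3)+
qed

lemma finite_I: "finite I" and finite_S: "finite S"
  using finite_V I_sub S_sub finite_subset by blast+

lemma I_nonadj: "u \<in> I \<Longrightarrow> v \<in> I \<Longrightarrow> \<not> E u v"
  using I_indep unfolding independent_def by blast

lemma card_S_diff_I:
  assumes "card I = card S"
  shows "card (S - I) = card (I - S)"
  using card_Diff_subset_Int[of S I] card_Diff_subset_Int[of I S] finite_I finite_S assms
  by (simp add: Int_commute)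

lemma ex_in_A_diff_I: "\<exists>a\<in>A. a \<notin> I" and ex_in_B_diff_I: "\<exists>b\<in>B. b \<notin> I"
  using nonempty no_isolated I_nonadj separated edge_sym by blast+

lemma indep_pair_dominates_but:
  assumes "u \<in> I" "v \<in> I" "u \<noteq> v"
  shows "(\<exists>w. dominates_but u w v) \<or> (\<exists>w. dominates_but v w u)"
proof -
  have "card {u, v} < card I" using card_I_ge_3 assms(3) by simp
  then have "I - {u, v} \<noteq> {}" using card_mono[of "{u, v}" I] by auto
  then obtain t where "t \<in> I" "t \<noteq> u" "t \<noteq> v" by blast
  moreover have "independent E {u, v, t}" "{u, v, t} \<subseteq> V"
    using calculation(1) assms(1,2) I_nonadj I_sub unfolding independent_def by blast+
  ultimately show ?thesis using edge_critical_imp_dominates_but[OF edge_critical] assms(3) by blast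
qed

definition misses_only :: "'a \<Rightarrow> 'a \<Rightarrow> bool" where
  "misses_only w v \<longleftrightarrow> v \<in> I \<and> (\<forall>u\<in>I. E w u \<longleftrightarrow> u \<noteq> v)"

lemma misses_onlyD:
  assumes "misses_only w v"
  shows "v \<in> I" "\<not> E w v" "\<not> E v w" "u \<in> I \<Longrightarrow> u \<noteq> v \<Longrightarrow> E w u" "u \<in> I \<Longrightarrow> u \<noteq> v \<Longrightarrow> E u w"
  using assms edge_sym unfolding misses_only_def by blast+

lemma misses_only_unique: "misses_only w v \<Longrightarrow> misses_only w v' \<Longrightarrow> v = v'"
  unfolding misses_only_def by blast

lemma inj_on_misses_only:
  assumes "\<And>v. v \<in> M \<Longrightarrow> misses_only (f v) v"
  shows "inj_on f M"
  using assms misses_only_unique by (metis inj_onI)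

lemma dominates_but_misses_only:
  assumes "dominates_but u w v" "u \<in> I" "v \<in> I"
  shows "w \<notin> I" "misses_only w v"
proof -
  show "w \<notin> I" using dominates_butD(1)[OF assms(1)] assms(2) I_nonadj by blast
  then show "misses_only w v"
    using dominates_butD(1,9)[OF assms(1)] dominates_but_cover[OF assms(1)] edge_sym
      assms(2,3) I_nonadj I_sub unfolding misses_only_def by blast
qed

lemma dominates_but_in_S_diff_I:
  assumes "dominates_but u w v" "u \<in> I - S" "v \<in> I"
  shows "w \<in> S - I"
  using dominates_but_misses_only(1)[OF assms(1) _ assms(3)] assms(1,2)
    partner_of_A_in_S partner_of_B_in_S I_sub V_eq by blast

lemma adj_if_misses_only:
  assumes "dominates_but u w v" "u \<in> I" "v \<in> I" "misses_only w' u"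
  shows "E w w'"
proof (rule dominates_but_cover[OF assms(1)])
  have "u \<noteq> v" using dominates_butD(6)[OF assms(1)] .
  then have "E w' v" using misses_onlyD(4)[OF assms(4)] assms(3) by blast
  then show "w' \<in> V" "w' \<noteq> v" "w' \<noteq> u" using edge_in_V edge_irrefl I_nonadj assms(2,3) by blast+
  show "\<not> E u w'" using misses_onlyD(3)[OF assms(4)] .
  show "w' \<noteq> w"
    using dominates_but_misses_only(2)[OF assms(1-3)] assms(4) misses_only_unique \<open>u \<noteq> v\<close> by blast
qed

lemma partner_of_I_complete:
  assumes "dominates_but p q c" "p \<in> I" "c \<notin> I" "u \<in> I"
  shows "E q u"
proof (cases "u = p")
  case True
  then show ?thesis using dominates_butD(1)[OF assms(1)] edge_sym by blast
next
  case False
  moreover have "q \<notin> I" using dominates_butD(1)[OF assms(1)] assms(2) I_nonadj by blast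
  ultimately show ?thesis
    using dominates_but_cover[OF assms(1), of u] assms(2-4) I_nonadj I_sub by blast
qed

lemma I_not_subset_S:
  assumes "card I = card S"
  shows "I - S \<noteq> {}"
proof
  assume "I - S = {}"
  then have "I = S" using card_subset_eq[OF finite_S] assms by blast
  obtain a where a: "a \<in> A" using nonempty by blast
  then obtain p q where pq: "dominates_but p q a" "p \<in> S"
    using critical_pair_in_S A_sub by blast
  have complete: "E q s" if "s \<in> S" for s
    using partner_of_I_complete[OF pq(1)] pq(2) that a disjoint \<open>I = S\<close> by blast
  obtain s r where "dominates_but s r q" "s \<in> S"
    using critical_pair_in_S dominates_butD(5)[OF pq(1)] by blast
  then show False using complete dominates_butD(10) by blast
qed

(* Otherwise the vertices f v form a clique by adj_if_misses_only, and no critical pair of f v0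
   meets S. *)
lemma ex_dominating_pair_outside_S:
  assumes bij: "bij_betw f M (S - I)"
    and f_misses: "\<And>v. v \<in> M \<Longrightarrow> misses_only (f v) v"
    and v0: "v0 \<in> M" "v0 \<notin> S"
  shows "\<exists>u\<in>M. \<exists>v\<in>M. \<exists>w. dominates_but u w v \<and> w \<notin> S"
proof (rule ccontr)
  assume "\<not> ?thesis"
  then have partner_in_S: "w \<in> S" if "u \<in> M" "v \<in> M" "dominates_but u w v" for u w v
    using that by blast
  have M_sub: "v \<in> I" if "v \<in> M" for v using f_misses[OF that] misses_onlyD(1) by blast
  have f_in: "f v \<in> S - I" if "v \<in> M" for v using bij that bij_betwE by blast
  have f_onto: "\<exists>v\<in>M. w = f v" if "w \<in> S - I" for w
    using bij that unfolding bij_betw_def by blast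
  have adj_f: "E (f v) (f u)" if uv: "u \<in> M" "v \<in> M" and w: "dominates_but u w v" for u w v
  proof -
    have missing: "w \<notin> I" "misses_only w v"
      using dominates_but_misses_only[OF w] uv M_sub by blast+
    then obtain v' where "v' \<in> M" "w = f v'" using partner_in_S[OF uv w] f_onto by blast
    then have "w = f v" using missing(2) f_misses misses_only_unique by blast
    then show ?thesis using adj_if_misses_only[OF w] f_misses uv M_sub by blast
  qed
  have clique: "E (f u) (f v)" if "u \<in> M" "v \<in> M" "u \<noteq> v" for u v
    using indep_pair_dominates_but[of u v] adj_f that M_sub edge_sym by blast
  obtain p q where pq: "dominates_but p q (f v0)" "p \<in> S"
    using critical_pair_in_S f_in[OF v0(1)] S_sub by blast
  have nonadj: "p \<noteq> f v0" "\<not> E (f v0) p" using dominates_butD(6,10)[OF pq(1)] .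
  then have "p \<notin> I" using misses_onlyD(4)[OF f_misses[OF v0(1)]] v0(2) pq(2) by blast
  then obtain u where "u \<in> M" "p = f u" using f_onto pq(2) by blast
  then show False using clique[OF v0(1)] nonadj by blast
qed

lemma ex_never_missed:
  assumes "card I = card S"
  shows "\<exists>x\<in>I - S. \<forall>u\<in>I - S. \<forall>w. \<not> dominates_but u w x"
proof (rule ccontr)
  assume "\<not> ?thesis"
  then have "\<forall>v\<in>I - S. \<exists>w. w \<in> S - I \<and> misses_only w v"
    using dominates_but_in_S_diff_I dominates_but_misses_only(2) by blast
  then obtain f where f: "\<And>v. v \<in> I - S \<Longrightarrow> f v \<in> S - I" "\<And>v. v \<in> I - S \<Longrightarrow> misses_only (f v) v"
    by metis
  have "inj_on f (I - S)" using inj_on_misses_only f(2) .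
  moreover from this have "f ` (I - S) = S - I"
    using f(1) finite_S card_image card_S_diff_I[OF assms] by (intro card_subset_eq) auto
  ultimately have "bij_betw f (I - S) (S - I)" unfolding bij_betw_def by blast
  moreover obtain v where "v \<in> I - S" using I_not_subset_S[OF assms] by blast
  ultimately show False
    using ex_dominating_pair_outside_S[of f "I - S" v] f(2) dominates_but_in_S_diff_I by blast
qed

end

locale source_in_A = separated_graph_with_indep_set +
  fixes x z :: 'a and mid :: "'a \<Rightarrow> 'a"
  assumes x_in_I: "x \<in> I" and x_notin_S: "x \<notin> S" and x_in_A: "x \<in> A"
    and dominates_but_mid: "v \<in> I - S - {x} \<Longrightarrow> dominates_but x (mid v) v"
    and S_diff_I_eq: "S - I = insert z (mid ` (I - S - {x}))"
    and z_notin_mids: "z \<notin> mid ` (I - S - {x})"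
begin

abbreviation targets :: "'a set" where "targets \<equiv> I - S - {x}"

lemma z_in: "z \<in> S" "z \<notin> I" "z \<in> V"
  using S_diff_I_eq S_sub by blast+

lemma mid_in: "v \<in> targets \<Longrightarrow> mid v \<in> S" "v \<in> targets \<Longrightarrow> mid v \<notin> I"
  using S_diff_I_eq by blast+

lemma S_diff_I_cases:
  assumes "p \<in> S" "p \<notin> I"
  obtains "p = z" | v where "v \<in> targets" "p = mid v"
  using assms S_diff_I_eq by blast

lemma x_adj_mid: "v \<in> targets \<Longrightarrow> E x (mid v)"
  using dominates_butD(1)[OF dominates_but_mid] .

lemma mid_misses_only: "v \<in> targets \<Longrightarrow> misses_only (mid v) v"
  using dominates_but_misses_only(2)[OF dominates_but_mid] x_in_I by blast

lemma eq_mid_if_misses_only: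
  assumes "p \<in> S" "misses_only p v" "p \<notin> I" "p \<noteq> z"
  shows "v \<in> targets" "p = mid v"
  using S_diff_I_cases[OF assms(1,3)] assms(2,4) mid_misses_only misses_only_unique by metis+

lemma mid_covers_B: "v \<in> targets \<Longrightarrow> b \<in> B \<Longrightarrow> b \<noteq> v \<Longrightarrow> E (mid v) b"
  using partner_of_A_covers_B[OF dominates_but_mid] x_in_A by blast

lemma x_adj_if_mid_nonadj:
  assumes "v \<in> targets" "\<not> E (mid v) u" "u \<in> V" "u \<noteq> mid v" "u \<noteq> v" "u \<noteq> x"
  shows "E x u"
  using dominates_but_cover[OF dominates_but_commute[OF dominates_but_mid]] assms by blast

lemma nonadj_mids_dominates_but_z:
  assumes "v \<in> targets" "v' \<in> targets" "v \<noteq> v'" "\<not> E (mid v) (mid v')"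
  shows "dominates_but v z v' \<or> dominates_but v' z v"
proof -
  have eq_z: "w = z"
    if w: "dominates_but a w b" and ab: "a \<in> targets" "b \<in> targets" "\<not> E (mid b) (mid a)" for a b w
  proof (rule ccontr)
    assume "w \<noteq> z"
    moreover have "w \<in> S - I" "misses_only w b"
      using dominates_but_in_S_diff_I[OF w] dominates_but_misses_only[OF w] ab(1,2) by blast+
    ultimately have "w = mid b" using eq_mid_if_misses_only by blast
    then show False using adj_if_misses_only[OF w] mid_misses_only ab by blast
  qed
  have "\<not> E (mid v') (mid v)" using assms(4) edge_sym by blast
  then show ?thesis using indep_pair_dominates_but[of v v'] eq_z assms by blast
qed

lemma critical_pair_of_mid:
  assumes v: "v \<in> targets" and clique: "\<And>u. u \<in> targets \<Longrightarrow> u \<noteq> v \<Longrightarrow> E (mid v) (mid u)"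
  obtains q where "dominates_but z q (mid v)" "q = v \<or> q \<in> A"
proof -
  have eq_z: "p = z" if p: "dominates_but p q (mid v)" "p \<in> S" for p q
  proof -
    have nonadj: "p \<noteq> mid v" "\<not> E (mid v) p" using dominates_butD(6,10)[OF p(1)] .
    then have "p \<notin> I" using misses_onlyD(4)[OF mid_misses_only[OF v]] p(2) v by blast
    with p(2) show ?thesis by (cases rule: S_diff_I_cases) (use nonadj clique in blast)+
  qed
  obtain p q where "dominates_but p q (mid v)" "p \<in> S"
    using critical_pair_in_S mid_in(1)[OF v] S_sub by blast
  then have zq: "dominates_but z q (mid v)" using eq_z by blast
  have "q \<notin> S" using eq_z[OF dominates_but_commute[OF zq]] dominates_butD(2)[OF zq] by blast
  have "E x q" if "q \<noteq> v"
    using x_adj_if_mid_nonadj[OF v dominates_butD(11,5,7)[OF zq] that]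
      x_adj_mid[OF v] dominates_butD(11)[OF zq] edge_sym by blast
  then have "q = v \<or> q \<in> A" using edge_from_A x_in_A \<open>q \<notin> S\<close> by blast
  then show thesis using that zq by blast
qed

lemma ex_dominates_but_z_if_no_targets:
  assumes "targets = {}"
  shows "\<exists>j\<in>I \<inter> S. dominates_but x z j"
proof -
  have S_eq: "p = z" if "p \<in> S" "p \<notin> I" for p using S_diff_I_eq assms that by blast
  obtain j r where j: "dominates_but j r z" "j \<in> S" using critical_pair_in_S z_in(3) by blast
  have nonadj: "j \<noteq> z" "\<not> E j z" "\<not> E z j" using dominates_butD(6,8,10)[OF j(1)] .
  then have "j \<in> I" using S_eq j(2) by blast
  have "\<not> dominates_but j w x" for w
  proof
    assume w: "dominates_but j w x"
    then have missing: "w \<notin> I" "misses_only w x"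
      using dominates_but_misses_only \<open>j \<in> I\<close> x_in_I by blast+
    have adj: "E w i" if "i \<in> I \<inter> S" for i
      using misses_onlyD(4)[OF missing(2)] that x_notin_S by blast
    obtain p q where pq: "dominates_but p q w" "p \<in> S"
      using critical_pair_in_S dominates_butD(5)[OF w] by blast
    then have "p \<notin> I" using adj dominates_butD(10) by blast
    then have "\<not> E w z" using S_eq pq dominates_butD(10) by blast
    moreover have "w \<noteq> z" using adj \<open>j \<in> I\<close> j(2) nonadj(3) by blast
    ultimately show False
      using dominates_but_cover[OF w, of z] z_in x_in_I nonadj by blast
  qed
  then obtain w where w: "dominates_but x w j"
    using indep_pair_dominates_but[of x j] x_in_I x_notin_S \<open>j \<in> I\<close> j(2) by blast
  then have "w = z" using dominates_but_in_S_diff_I S_eq x_in_I x_notin_S \<open>j \<in> I\<close> by blast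
  then show ?thesis using w \<open>j \<in> I\<close> j(2) by blast
qed

lemma z_in_dominating_pair:
  obtains (from_I) u c where "dominates_but u z c" "u \<in> I - S" "c \<in> I" "c \<noteq> x"
  | (at_mid) v q where "v \<in> targets" "dominates_but z q (mid v)" "q = v \<or> q \<in> A"
proof (cases "targets = {}")
  case True
  then show thesis using from_I ex_dominates_but_z_if_no_targets x_in_I x_notin_S by blast
next
  case False
  then obtain v where v: "v \<in> targets" by blast
  show thesis
  proof (cases "\<forall>u\<in>targets. u \<noteq> v \<longrightarrow> E (mid v) (mid u)")
    case True
    then show thesis using critical_pair_of_mid[OF v] at_mid[OF v] by blast
  next
    case False
    then obtain u where "u \<in> targets" "dominates_but v z u \<or> dominates_but u z v"
      using nonadj_mids_dominates_but_z[OF v] by blast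
    then show thesis using from_I v by blast
  qed
qed

lemma x_adj_z: "E x z"
proof (cases rule: z_in_dominating_pair)
  case (from_I u c)
  then have "misses_only z c" using dominates_but_misses_only by blast
  then show ?thesis using misses_onlyD(5) x_in_I from_I(4) by blast
next
  case (at_mid v q)
  show ?thesis
    using x_adj_if_mid_nonadj[OF at_mid(1) dominates_butD(10,4,6)[OF at_mid(2)]]
      z_in x_in_I at_mid(1) by blast
qed

lemma x_adj_S_diff_I: "p \<in> S \<Longrightarrow> p \<notin> I \<Longrightarrow> E x p"
  using S_diff_I_cases x_adj_z x_adj_mid by metis

lemma x_and_cut_vertex_dominate:
  assumes "j \<in> I" "j \<in> S"
  obtains "dominates_but x z j"
  | w where "dominates_but j w x" "w \<notin> S" "w \<notin> I" "misses_only w x"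
proof -
  consider w where "dominates_but x w j" | w where "dominates_but j w x"
    using indep_pair_dominates_but[of x j] assms x_in_I x_notin_S by blast
  then show thesis
  proof cases
    case (1 w)
    then have w: "w \<in> S" "w \<notin> I" "misses_only w j"
      using dominates_but_in_S_diff_I dominates_but_misses_only(2) assms(1) x_in_I x_notin_S
      by blast+
    then have "w = z" using eq_mid_if_misses_only(1) assms(2) by blast
    then show thesis using that(1) 1 by blast
  next
    case (2 w)
    then have w: "w \<notin> I" "misses_only w x"
      using dominates_but_misses_only assms(1) x_in_I by blast+
    then have "w \<notin> S" using x_adj_S_diff_I misses_onlyD(3) by blast
    then show thesis using that(2) 2 w by blast
  qed
qed

end

locale source_with_I_in_A = source_in_A +
  assumes I_in_A: "I - S \<subseteq> A"
begin

lemma targets_in_A: "v \<in> targets \<Longrightarrow> v \<in> A"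
  using I_in_A by blast

lemma z_covers_B:
  assumes "b \<in> B"
  shows "E z b"
proof (cases rule: z_in_dominating_pair)
  case (from_I u c)
  then have "u \<in> A" "b \<noteq> c" using I_in_A assms disjoint by blast+
  then show ?thesis using partner_of_A_covers_B[OF from_I(1)] assms by blast
next
  case (at_mid v q)
  then have "q \<in> A" "b \<noteq> mid v" using targets_in_A assms mid_in disjoint by blast+
  then show ?thesis
    using partner_of_A_covers_B[OF dominates_but_commute[OF at_mid(2)]] assms by blast
qed

lemma S_diff_I_covers_B:
  assumes "p \<in> S" "p \<notin> I" "b \<in> B"
  shows "E p b"
  using assms(1,2)
proof (cases rule: S_diff_I_cases)
  case 1
  then show ?thesis using z_covers_B assms(3) by blast
next
  case (2 v)
  then show ?thesis using mid_covers_B targets_in_A assms(3) disjoint by blast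
qed

lemma critical_pair_of_B_in_I:
  assumes "b \<in> B" "dominates_but p q b" "p \<in> S"
  shows "p \<in> I"
  using S_diff_I_covers_B assms dominates_butD(8) by blast

lemma cut_vertex_nonadj_B_dominates:
  assumes p: "p \<in> I" "p \<in> S" and b: "b \<in> B" "\<not> E p b"
  shows "dominates_but x z p" and "v \<in> targets \<Longrightarrow> dominates_but p w v \<Longrightarrow> w \<in> S"
proof -
  have in_B: "w \<in> B" if "dominates_but p w v" "w \<notin> S" "v \<in> A" for w v
    using partner_of_A_covers_B[OF dominates_but_commute[OF that(1)]] that b disjoint
      dominates_butD(5)[OF that(1)] V_eq by blast
  have not_in_B: "w \<notin> B" if "misses_only w x" for w
  proof
    assume "w \<in> B"
    then obtain j r where j: "dominates_but j r w" "j \<in> S" using critical_pair_in_S B_sub by blast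
    then have "j \<in> I" using critical_pair_of_B_in_I \<open>w \<in> B\<close> by blast
    then show False using misses_onlyD(4)[OF that] j x_notin_S dominates_butD(10) by blast
  qed
  show "dominates_but x z p"
    using x_and_cut_vertex_dominate[OF p] in_B not_in_B x_in_A by metis
  show "w \<in> S" if "v \<in> targets" "dominates_but p w v"
  proof (rule ccontr)
    assume "w \<notin> S"
    then have "w \<in> B" using in_B that targets_in_A by blast
    moreover have "E w x"
      using dominates_but_misses_only(2)[OF that(2) p(1)] misses_onlyD(4) that(1) x_in_I by blast
    ultimately show False using separated edge_sym x_in_A by blast
  qed
qed

lemma no_targets_if_cut_vertex_nonadj_B:
  assumes p: "p \<in> I" "p \<in> S" and b: "b \<in> B" "\<not> E p b"
  shows "targets = {}"
proof (rule ccontr)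
  assume "targets \<noteq> {}"
  then obtain v where v: "v \<in> targets" by blast
  let ?f = "mid(p := z)" and ?M = "insert p targets"
  have z_misses: "misses_only z p"
    using dominates_but_misses_only(2)[OF cut_vertex_nonadj_B_dominates(1)[OF p b]] x_in_I p(1) .
  have f_misses: "misses_only (?f u) u" if "u \<in> ?M" for u
    using that z_misses mid_misses_only by auto
  moreover have "?f ` ?M = S - I" using S_diff_I_eq p(2) by auto
  ultimately have "bij_betw ?f ?M (S - I)"
    using inj_on_misses_only[of ?M ?f] unfolding bij_betw_def by blast
  then obtain u t w where w: "u \<in> ?M" "t \<in> ?M" "dominates_but u w t" "w \<notin> S"
    using ex_dominating_pair_outside_S[of ?f ?M v] f_misses v by blast
  then show False
    using dominates_but_in_S_diff_I[OF w(3)] cut_vertex_nonadj_B_dominates(2)[OF p b]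
      dominates_butD(6)[OF w(3)] p(1) by blast
qed

lemma targets_nonempty_if_cut_vertex_dominates:
  assumes pq: "dominates_but p q b" and p: "p \<in> I" "p \<in> S" and b: "b \<in> B" "b \<notin> I"
  shows "targets \<noteq> {}"
proof
  assume "targets = {}"
  obtain r t where r: "dominates_but r t q" "r \<in> S"
    using critical_pair_in_S dominates_butD(5)[OF pq] by blast
  then have "r \<notin> I" using partner_of_I_complete[OF pq p(1) b(2)] dominates_butD(10) by blast
  then have "r = z" using S_diff_I_eq \<open>targets = {}\<close> r(2) by blast
  then have "\<not> E q z" "z \<noteq> q" using dominates_butD(4,6,10)[OF r(1)] by blast+
  moreover have "z \<noteq> b" "z \<noteq> p" using z_in b disjoint p by blast+
  ultimately have "E p z"
    using dominates_but_cover[OF dominates_but_commute[OF pq]] z_in(3) by blast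
  moreover have "dominates_but x z p"
    using cut_vertex_nonadj_B_dominates(1)[OF p b(1)] dominates_butD(8)[OF pq] .
  ultimately show False using dominates_butD(11) by blast
qed

lemma inconsistent: False
proof -
  obtain b where b: "b \<in> B" "b \<notin> I" using ex_in_B_diff_I by blast
  then obtain p q where pq: "dominates_but p q b" "p \<in> S" using critical_pair_in_S B_sub by blast
  then have "p \<in> I" using critical_pair_of_B_in_I b(1) by blast
  then show False
    using no_targets_if_cut_vertex_nonadj_B targets_nonempty_if_cut_vertex_dominates
      pq b dominates_butD(8) by blast
qed

end

locale source_with_I_on_both_sides = source_in_A +
  fixes x' :: 'a
  assumes x'_in_I: "x' \<in> I" and x'_notin_S: "x' \<notin> S" and x'_in_B: "x' \<in> B"
begin

lemma x'_target: "x' \<in> targets"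
  using x'_in_I x'_notin_S x'_in_B x_in_A disjoint by blast

lemma partner_of_I_eq_z:
  assumes "dominates_but p q c" "p \<in> I" "c \<notin> I"
  shows "q = z"
proof -
  have complete: "E q u" if "u \<in> I" for u using partner_of_I_complete[OF assms that] .
  have "q \<in> A \<inter> B" if "q \<notin> S"
    using edge_from_A[OF edge_sym[OF complete[OF x_in_I]] x_in_A that]
      edge_from_B[OF edge_sym[OF complete[OF x'_in_I]] x'_in_B that] by blast
  then have "q \<in> S" using disjoint by blast
  moreover have "q \<notin> I" using complete edge_irrefl by blast
  ultimately show ?thesis
    by (cases rule: S_diff_I_cases) (use complete mid_misses_only misses_onlyD(1,2) in blast)+
qed

lemma z_nonadj_B_diff_I:
  assumes "b \<in> B" "b \<notin> I"
  shows "\<not> E z b"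
proof
  assume "E z b"
  obtain p q where pq: "dominates_but p q b" "p \<in> S"
    using critical_pair_in_S assms(1) B_sub by blast
  have "E r b" if "r \<in> S" "r \<notin> I" for r
    using that by (cases rule: S_diff_I_cases) (use \<open>E z b\<close> mid_covers_B assms in blast)+
  then have "p \<in> I" using pq dominates_butD(8) by blast
  then show False
    using partner_of_I_eq_z[OF pq(1)] assms(2) \<open>E z b\<close> dominates_butD(9)[OF pq(1)] by blast
qed

lemma ex_in_B_misses_only_x:
  obtains w where "w \<in> B" "w \<notin> I" "misses_only w x"
proof -
  obtain j r where j: "dominates_but j r x" "j \<in> S" using critical_pair_in_S x_in_I I_sub by blast
  have "j \<in> I" using x_adj_S_diff_I j dominates_butD(10) by blast
  then show thesis
    using j(2)
  proof (cases rule: x_and_cut_vertex_dominate)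
    case 1
    obtain b where b: "b \<in> B" "b \<notin> I" using ex_in_B_diff_I by blast
    then have "E z b" using partner_of_A_covers_B[OF 1 x_in_A] j(2) disjoint by blast
    then show thesis using z_nonadj_B_diff_I b by blast
  next
    case (2 w)
    have "E x' w" using misses_onlyD(5)[OF 2(4)] x'_target by blast
    then have "w \<in> B" using edge_from_B x'_in_B 2(2) by blast
    then show thesis using that 2 by blast
  qed
qed

lemma targets_in_B:
  assumes "v \<in> targets"
  shows "v \<in> B"
proof -
  obtain w where "w \<in> B" "misses_only w x" using ex_in_B_misses_only_x by blast
  then show ?thesis using edge_from_B misses_onlyD(4) assms by blast
qed

lemma z_adj_targets:
  assumes "v \<in> targets"
  shows "E z v"
proof -
  obtain w where w: "w \<in> B" "w \<notin> I" "misses_only w x" using ex_in_B_misses_only_x by blast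
  have eq_z: "p = z" if p: "dominates_but p q w" "p \<in> S" for p q
  proof -
    have "p \<notin> I" using misses_onlyD(4)[OF w(3)] p x_notin_S dominates_butD(10) by blast
    with p(2) show ?thesis
      by (cases rule: S_diff_I_cases) (use mid_covers_B w dominates_butD(8)[OF p(1)] in blast)+
  qed
  obtain p q where "dominates_but p q w" "p \<in> S" using critical_pair_in_S w(1) B_sub by blast
  then have zq: "dominates_but z q w" using eq_z by blast
  have "q \<notin> S" using eq_z[OF dominates_but_commute[OF zq]] dominates_butD(2)[OF zq] by blast
  have "q \<notin> B"
  proof
    assume "q \<in> B"
    then have "q \<in> I" using z_nonadj_B_diff_I dominates_butD(1)[OF zq] by blast
    then show False
      using misses_onlyD(4)[OF w(3)] dominates_butD(11)[OF zq] \<open>q \<in> B\<close> x_in_A disjoint by blast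
  qed
  then have "q \<in> A" using dominates_butD(5)[OF zq] V_eq \<open>q \<notin> S\<close> by blast
  then show ?thesis
    using partner_of_A_covers_B[OF dominates_but_commute[OF zq]] targets_in_B assms w(2) by blast
qed

lemma z_mid_dominate_but_mid:
  assumes "v \<in> targets"
  shows "dominates_but z v (mid v)"
proof -
  have "E (mid v) (mid u)" if u: "u \<in> targets" "u \<noteq> v" for u
  proof (rule ccontr)
    assume "\<not> ?thesis"
    then have "dominates_but v z u \<or> dominates_but u z v"
      using nonadj_mids_dominates_but_z assms u by blast
    then show False using z_adj_targets assms u dominates_butD(9) by blast
  qed
  then obtain q where q: "dominates_but z q (mid v)" "q = v \<or> q \<in> A"
    using critical_pair_of_mid[OF assms] by blast
  have "q \<notin> A"
  proof
    assume "q \<in> A"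
    obtain b where b: "b \<in> B" "b \<notin> I" using ex_in_B_diff_I by blast
    then have "E z b"
      using partner_of_A_covers_B[OF dominates_but_commute[OF q(1)] \<open>q \<in> A\<close>]
        mid_in(1)[OF assms] disjoint by blast
    then show False using z_nonadj_B_diff_I b by blast
  qed
  then show ?thesis using q by blast
qed

lemma z_nonadj_mid: "v \<in> targets \<Longrightarrow> \<not> E z (mid v)"
  using dominates_butD(8)[OF z_mid_dominate_but_mid] .

lemma z_adj_A: "a \<in> A \<Longrightarrow> E z a"
  using partner_of_B_covers_A[OF dominates_but_commute[OF z_mid_dominate_but_mid[OF x'_target]]]
    x'_in_B mid_in(1)[OF x'_target] disjoint by blast

lemma critical_pair_of_A_diff_I:
  assumes a: "a \<in> A" "a \<notin> I" and pq: "dominates_but p q a" and p: "p \<in> S"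
  shows "\<exists>v\<in>targets. p = mid v"
proof -
  have "q \<noteq> z" "p \<noteq> z" using z_adj_A[OF a(1)] dominates_butD(8,9)[OF pq] by blast+
  then have "p \<notin> I" using partner_of_I_eq_z[OF pq] a(2) by blast
  then show ?thesis using p \<open>p \<noteq> z\<close> S_diff_I_cases by metis
qed

lemma inconsistent: False
proof -
  obtain a where a: "a \<in> A" "a \<notin> I" using ex_in_A_diff_I by blast
  then obtain p q where pq: "dominates_but p q a" "p \<in> S" using critical_pair_in_S A_sub by blast
  then obtain v where v: "v \<in> targets" "p = mid v" using critical_pair_of_A_diff_I a by blast
  have "q \<noteq> z" "z \<noteq> a" "z \<noteq> p"
    using z_adj_A[OF a(1)] dominates_butD(9)[OF pq(1)] edge_irrefl v S_diff_I_eq z_notin_mids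
    by blast+
  then have "E q z"
    using dominates_but_cover[OF pq(1), of z] z_nonadj_mid[OF v(1)] v(2) edge_sym z_in(3) by blast
  then have "q \<notin> S"
    using critical_pair_of_A_diff_I[OF a dominates_but_commute[OF pq(1)]] z_nonadj_mid edge_sym
    by blast
  have "\<not> E p v" "v \<noteq> p" "v \<noteq> a" "v \<in> V"
    using misses_onlyD(2)[OF mid_misses_only[OF v(1)]] v pq(2) a I_sub by blast+
  moreover from this have "q \<noteq> v" using dominates_butD(1)[OF pq(1)] by blast
  ultimately have "E v q" using dominates_but_cover[OF pq(1), of v] edge_sym by blast
  then have "q \<in> B" "q \<notin> I"
    using edge_from_B targets_in_B[OF v(1)] \<open>q \<notin> S\<close> I_nonadj v(1) by blast+
  then show False using z_nonadj_B_diff_I \<open>E q z\<close> edge_sym by blast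
qed

end

lemma (in source_in_A) inconsistent: False
proof (cases "I - S \<subseteq> A")
  case True
  then interpret source_with_I_in_A V E S A B I x z mid by unfold_locales
  show False by (rule inconsistent)
next
  case False
  then obtain x' where "x' \<in> I" "x' \<notin> S" "x' \<in> B" using I_sub V_eq by blast
  then interpret source_with_I_on_both_sides V E S A B I x z mid x' by unfold_locales
  show False by (rule inconsistent)
qed

lemma (in separated_graph_with_indep_set) never_missed_notin_A:
  assumes "card I = card S" and x: "x \<in> I - S"
    and never_missed: "\<forall>u\<in>I - S. \<forall>w. \<not> dominates_but u w x"
  shows "x \<notin> A"
proof
  assume "x \<in> A"
  let ?targets = "I - S - {x}"
  have "\<forall>v\<in>?targets. \<exists>w. dominates_but x w v" using indep_pair_dominates_but never_missed x by blast
  then obtain mid where mid: "\<And>v. v \<in> ?targets \<Longrightarrow> dominates_but x (mid v) v" by metis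
  have sub: "mid ` ?targets \<subseteq> S - I" using dominates_but_in_S_diff_I[OF mid x] by blast
  have "inj_on mid ?targets"
    using dominates_but_misses_only(2)[OF mid] x by (intro inj_on_misses_only) blast
  then have "card (S - I - mid ` ?targets) = card (I - S) - card ?targets"
    using card_Diff_subset[OF _ sub] finite_I by (simp add: card_image card_S_diff_I[OF assms(1)])
  also have "\<dots> = 1" using card.remove[of "I - S" x] finite_I x by simp
  finally obtain z where "S - I - mid ` ?targets = {z}" by (rule card_1_singletonE)
  then have "source_in_A V E S A B I x z mid"
    using x \<open>x \<in> A\<close> mid sub by unfold_locales blast+
  then show False by (rule source_in_A.inconsistent)
qed

lemma (in separated_graph_with_indep_set) card_I_neq_card_S: "card I \<noteq> card S"
proof
  assume card: "card I = card S"
  interpret swapped: separated_graph_with_indep_set V E S B A I by (rule swap_with_indep_set)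
  obtain x where x: "x \<in> I - S" "\<forall>u\<in>I - S. \<forall>w. \<not> dominates_but u w x"
    using ex_never_missed[OF card] by blast
  then have "x \<notin> A" "x \<notin> B"
    using never_missed_notin_A[OF card] swapped.never_missed_notin_A[OF card] by blast+
  then show False using x(1) I_sub V_eq by blast
qed

lemma (in separated_critical_graph) indep_number_neq_card_S: "indep_number V E \<noteq> card S"
proof
  assume alpha: "indep_number V E = card S"
  then have "3 \<le> card S" using card_S_ge_2 indep_number_gt_2_if_card_S_eq_2 by linarith
  moreover obtain I where I: "I \<subseteq> V" "independent E I" "card I = card S"
    using indep_number_attained[OF finite_V] alpha by metis
  ultimately have "separated_graph_with_indep_set V E S A B I"
    by unfold_locales simp_all
  then show False using separated_graph_with_indep_set.card_I_neq_card_S I(3) by blast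
qed

theorem theorem4p6:
  fixes V :: "'a set" and E :: "'a \<Rightarrow> 'a \<Rightarrow> bool"
  assumes "simple_graph V E"
    and "conn_on E V"
    and "maximal_vertex_critical 3 V E"
    and "indep_number V E = connectivity V E"
    and "vertex_cut V E S"
    and "card S = connectivity V E"
  shows "\<exists>C. is_component E (V - S) C \<and> card C = 1"
proof (rule ccontr)
  assume "\<not> ?thesis"
  then have no_singleton: "\<not> is_component E (V - S) {v}" for v
    using is_singletonI is_singleton_altdef by metis
  have "gamma_c V E = 3"
    using assms(3) unfolding maximal_vertex_critical_def edge_critical_def by blast
  then interpret maximal_critical_graph V E using assms(1-3) by unfold_locales
  obtain A B where "separated_critical_graph V E S A B"
    using separated_if_no_singleton_component[OF assms(5) no_singleton] by blast
  then have "indep_number V E \<noteq> card S"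
    by (rule separated_critical_graph.indep_number_neq_card_S)
  then show False using assms(4,6) by simp
qed

end
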